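(* Let $G$ be a graph, let $e\in E(G)$, and let $G' = G\setminus e$ be the graph obtained from $G$ by deleting the edge $e$ (keeping all vertices). Then $\mathrm{USN}(G')\le \mathrm{USN}(G)+1$.
   Context: Graphs are finite, simple and undirected. A valid labelling of a graph $G$ with universe a finite set $S$ assigns to the vertices of $G$ pairwise distinct nonempty subsets of $S$ such that two distinct vertices are adjacent if and only if their labels are disjoint. The universe size number $\mathrm{USN}(G)$ is the minimum of $|S|$ over all finite sets $S$ for which $G$ has a valid labelling with universe $S$. *)

theory Defs
  imports Main
begin

definition simple_graph :: "'a set \<Rightarrow> 'a set set \<Rightarrow> bool" where
  "simple_graph V E \<longleftrightarrow> finite V \<and> (\<forall>e\<in>E. e \<subseteq> V \<and> card e = 2)"

definition valid_labelling :: "'a set \<Rightarrow> 'a set set \<Rightarrow> 'b set \<Rightarrow> ('a \<Rightarrow> 'b set) \<Rightarrow> bool" where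
  "valid_labelling V E S L \<longleftrightarrow>
     (\<forall>v\<in>V. L v \<subseteq> S \<and> L v \<noteq> {}) \<and>
     inj_on L V \<and>
     (\<forall>u\<in>V. \<forall>v\<in>V. u \<noteq> v \<longrightarrow> ({u, v} \<in> E \<longleftrightarrow> L u \<inter> L v = {}))"

text \<open>Universes are taken inside \<^typ>\<open>nat\<close>; by \<open>USN_le\<close> and \<open>USN_attained\<close> below,
  the value is the minimum over finite universes of arbitrary type.\<close>

definition USN :: "'a set \<Rightarrow> 'a set set \<Rightarrow> nat" where
  "USN V E = (LEAST n. \<exists>(S :: nat set) L. finite S \<and> card S = n \<and> valid_labelling V E S L)"

lemma valid_labelling_image:
  assumes "valid_labelling V E S L" "inj_on f S"
  shows "valid_labelling V E (f ` S) (\<lambda>v. f ` L v)"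
proof -
  have sub: "L v \<subseteq> S" if "v \<in> V" for v
    using assms(1) that by (auto simp: valid_labelling_def)
  have "inj_on (\<lambda>v. f ` L v) V"
  proof (rule inj_onI)
    fix u v assume uv: "u \<in> V" "v \<in> V" "f ` L u = f ` L v"
    then have "L u = L v"
      using inj_on_image_eq_iff[OF assms(2)] sub by blast
    then show "u = v"
      using assms(1) uv by (auto simp: valid_labelling_def inj_on_def)
  qed
  moreover have "f ` L u \<inter> f ` L v = {} \<longleftrightarrow> L u \<inter> L v = {}" if "u \<in> V" "v \<in> V" for u v
    using inj_on_image_Int[OF assms(2) sub[OF that(1)] sub[OF that(2)]] by (metis image_is_empty)
  ultimately show ?thesis
    using assms(1) sub unfolding valid_labelling_def by (simp add: image_mono)
qed

lemma USN_le:
  fixes S :: "'b set"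
  assumes "valid_labelling V E S L" "finite S"
  shows "USN V E \<le> card S"
proof -
  obtain f :: "'b \<Rightarrow> nat" where f: "inj_on f S"
    using finite_imp_inj_to_nat_seg[OF assms(2)] by blast
  have "finite (f ` S) \<and> card (f ` S) = card S \<and> valid_labelling V E (f ` S) (\<lambda>v. f ` L v)"
    using valid_labelling_image[OF assms(1) f] assms(2) card_image[OF f] by simp
  then show ?thesis
    unfolding USN_def by (intro Least_le) blast
qed

lemma valid_labelling_exists:
  assumes "simple_graph V E"
  shows "\<exists>(S :: 'a set set) L. finite S \<and> valid_labelling V E S (L :: 'a \<Rightarrow> 'a set set)"
proof -
  let ?L = "\<lambda>v. insert {v} {{v, w} |w. w \<in> V \<and> {v, w} \<notin> E}"
  have mem: "x \<in> ?L v \<longleftrightarrow> x = {v} \<or> (\<exists>w. x = {v, w} \<and> w \<in> V \<and> {v, w} \<notin> E)" for x v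
    by blast
  have "inj_on ?L V"
  proof (rule inj_onI)
    fix u v assume eq: "?L u = ?L v"
    have "{u} \<in> ?L u" by (rule insertI1)
    then have "{u} \<in> ?L v" unfolding eq .
    then have "v \<in> {u}" unfolding mem by (elim disjE exE conjE) simp_all
    then show "u = v" by simp
  qed
  moreover have "{u, v} \<in> E \<longleftrightarrow> ?L u \<inter> ?L v = {}" if uv: "u \<in> V" "v \<in> V" "u \<noteq> v" for u v
  proof
    assume edge: "{u, v} \<in> E"
    have False if x: "x \<in> ?L u" "x \<in> ?L v" for x
    proof -
      have "v \<in> x" using x(2) unfolding mem by (elim disjE exE conjE) simp_all
      moreover have "x = {u} \<or> (\<exists>w. x = {u, w} \<and> {u, w} \<notin> E)"
        using x(1) unfolding mem by metis
      ultimately show False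
        using uv(3) edge by auto
    qed
    then show "?L u \<inter> ?L v = {}" by (intro equals0I) (elim IntE)
  next
    assume disj: "?L u \<inter> ?L v = {}"
    show "{u, v} \<in> E"
    proof (rule ccontr)
      assume nonedge: "{u, v} \<notin> E"
      have sym: "{u, v} = {v, u}" by (rule insert_commute)
      have "{u, v} \<in> ?L u" unfolding mem using uv(2) nonedge by (intro disjI2 exI[of _ v]) simp
      moreover have "{u, v} \<in> ?L v" unfolding mem using uv(1) nonedge sym
        by (intro disjI2 exI[of _ u]) metis
      ultimately have "{u, v} \<in> ?L u \<inter> ?L v" by (rule IntI)
      then show False unfolding disj by (rule emptyE)
    qed
  qed
  moreover have "\<forall>v\<in>V. ?L v \<subseteq> Pow V \<and> ?L v \<noteq> {}"
    by auto
  ultimately have "valid_labelling V E (Pow V) ?L"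
    unfolding valid_labelling_def by (intro conjI ballI impI) simp_all
  moreover have "finite (Pow V)"
    using assms by (simp add: simple_graph_def)
  ultimately show ?thesis by blast
qed

lemma USN_attained:
  assumes "simple_graph V E"
  shows "\<exists>(S :: nat set) L. finite S \<and> card S = USN V E \<and> valid_labelling V E S L"
proof -
  obtain S :: "'a set set" and L where SL: "finite S" "valid_labelling V E S L"
    using valid_labelling_exists[OF assms] by blast
  obtain f :: "'a set \<Rightarrow> nat" where f: "inj_on f S"
    using finite_imp_inj_to_nat_seg[OF SL(1)] by blast
  have "\<exists>(T :: nat set) M. finite T \<and> card T = card (f ` S) \<and> valid_labelling V E T M"
    using valid_labelling_image[OF SL(2) f] SL(1) by blast
  then show ?thesis
    unfolding USN_def by (rule LeastI)
qed

end

theory Submission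
  imports Defs
begin

text \<open>Adding one fresh element to the labels of both ends of \<open>e\<close> makes exactly that pair of labels
  intersect. Intersecting with the old universe recovers the old labels, so they stay distinct.\<close>

lemma valid_labelling_delete_edge:
  assumes L: "valid_labelling V E S L" and "z \<notin> S" and "card e = 2"
  shows "valid_labelling V (E - {e}) (insert z S) (\<lambda>w. if w \<in> e then insert z (L w) else L w)"
    (is "valid_labelling _ _ _ ?M")
proof -
  have sub: "L w \<subseteq> S" "L w \<noteq> {}" if "w \<in> V" for w
    using L that by (auto simp: valid_labelling_def)
  have fresh: "z \<notin> L w" if "w \<in> V" for w
    using sub(1)[OF that] \<open>z \<notin> S\<close> by blast
  have restrict: "?M w \<inter> S = L w" if "w \<in> V" for w
    using sub(1)[OF that] \<open>z \<notin> S\<close> by auto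
  have "inj_on ?M V"
  proof (rule inj_onI)
    fix u v assume uv: "u \<in> V" "v \<in> V" "?M u = ?M v"
    then have "L u = L v"
      using restrict by metis
    then show "u = v"
      using L uv(1,2) by (auto simp: valid_labelling_def inj_on_def)
  qed
  moreover have "{u, v} \<in> E - {e} \<longleftrightarrow> ?M u \<inter> ?M v = {}"
    if uv: "u \<in> V" "v \<in> V" "u \<noteq> v" for u v
  proof -
    \<comment> \<open>As \<open>u\<close> and \<open>v\<close> are distinct and \<open>e\<close> has
      exactly two elements, being the deleted edge amounts to the membership tests that decide which
      labels receive \<open>z\<close>.\<close>
    have "{u, v} = e \<longleftrightarrow> u \<in> e \<and> v \<in> e"
      using \<open>card e = 2\<close> uv(3) by (auto simp: card_2_iff)
    moreover have "{u, v} \<in> E \<longleftrightarrow> L u \<inter> L v = {}"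
      using L uv by (simp add: valid_labelling_def)
    \<comment> \<open>By freshness of \<open>z\<close>, the new intersection is
      \<open>L u \<inter> L v\<close>, with \<open>z\<close> added exactly when both vertices lie in
      \<open>e\<close>.\<close>
    ultimately show ?thesis
      using fresh[OF uv(1)] fresh[OF uv(2)] by auto
  qed
  moreover have "\<forall>w\<in>V. ?M w \<subseteq> insert z S \<and> ?M w \<noteq> {}"
    using sub by (simp add: insert_mono subset_insertI2)
  ultimately show ?thesis
    unfolding valid_labelling_def by simp
qed

theorem theorem18:
  fixes V :: "'a set" and E :: "'a set set" and e :: "'a set"
  assumes "simple_graph V E"
    and "e \<in> E"
  shows "USN V (E - {e}) \<le> USN V E + 1"
proof -
  obtain S :: "nat set" and L
    where S: "finite S" "card S = USN V E" and L: "valid_labelling V E S L"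
    using USN_attained[OF assms(1)] by blast
  \<comment> \<open>An optimal universe inside \<open>nat\<close> is finite, so it leaves room for a
    new element.\<close>
  obtain z where z: "z \<notin> S"
    using ex_new_if_finite[OF infinite_UNIV_nat S(1)] by blast
  have "card e = 2"
    using assms by (simp add: simple_graph_def)
  \<comment> \<open>Since \<open>z\<close> is outside \<open>S\<close>, the enlarged universe has
    size \<open>USN V E + 1\<close>.\<close>
  from USN_le[OF valid_labelling_delete_edge[OF L z this]] show ?thesis
    using S z by simp
qed

end
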